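(* Let $\nu$ be a compactly supported Borel probability measure on $\mathbb{R}^d$. For every $r>0$ one has $q_r=\overline{D}_r(\nu)/(r+\overline{D}_r(\nu))$, and hence, if $\overline{D}_r(\nu)>0$, then \[ \beta_{\nu}\left(\frac{\overline{D}_{r}(\nu)}{\overline{D}_{r}(\nu)+r}\right)=\frac{r\,\overline{D}_{r}(\nu)}{\overline{D}_{r}(\nu)+r}. \] Moreover, set $q_{0}=\sup\left\{\overline{D}_{r}(\nu)/(r+\overline{D}_{r}(\nu)):r>0\right\}$. Then $\beta_{\nu}(q)=0$ for all $q\in(q_{0},1]$, and for all $q\in(0,q_{0})$ we have $\beta_{\nu}(q)>0$ and \[ \overline{D}_{\beta_{\nu}(q)/q}(\nu)=\frac{\beta_{\nu}(q)}{1-q}. \]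
   Context: For $n\in\mathbb{N}$ let $\mathcal{D}_n$ be the partition of $\mathbb{R}^d$ into half-open cubes $\prod_{i=1}^d(k_i2^{-n},(k_i+1)2^{-n}]$, $k\in\mathbb{Z}^d$. For $r>0$ let $\mathfrak{e}_{n,r}(\nu)=\inf\left\{\left(\int d(x,\alpha)^r\,d\nu(x)\right)^{1/r}:\alpha\subset\mathbb{R}^d,\ 1\le\mathrm{card}(\alpha)\le n\right\}$ with $d(x,\alpha)=\min_{y\in\alpha}\|x-y\|$. The upper quantization dimension of order $r$ is $\overline{D}_r(\nu)=\limsup_{n\to\infty}\frac{\log n}{-\log\mathfrak{e}_{n,r}(\nu)}$ (the quotient is $0$ if $\mathfrak{e}_{n,r}(\nu)=0$). The $L^q$-spectrum is, for $q\ge0$, $\beta_\nu(q)=\limsup_{n\to\infty}\frac{\log\left(\sum_{C\in\mathcal{D}_n}\nu(C)^q\right)}{\log(2^n)}$ (with $0^0=0$), and for $r>0$, $q_r=\inf\{q>0:\beta_\nu(q)<rq\}$. *)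

theory Defs
  imports "HOL-Analysis.Analysis" "HOL-Probability.Probability"
begin

definition dyadic_cubes :: "nat \<Rightarrow> (real ^ 'd) set set" where
  "dyadic_cubes n =
     range (\<lambda>k :: 'd \<Rightarrow> int.
       {x. \<forall>i. of_int (k i) / 2 ^ n < x $ i \<and> x $ i \<le> (of_int (k i) + 1) / 2 ^ n})"

definition msupport :: "'a :: topological_space measure \<Rightarrow> 'a set" where
  "msupport \<nu> = {x. \<forall>U. open U \<and> x \<in> U \<longrightarrow> emeasure \<nu> U > 0}"

text \<open>The integral is a Bochner integral, with value 0 on non-integrable functions. For a
  compactly supported probability measure the integrand is bounded almost everywhere, so it is
  integrable. The infimum is meaningful for \<open>n \<ge> 1\<close>; the value at \<open>n = 0\<close> is irrelevant below.\<close>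

definition quant_error :: "(real ^ 'd) measure \<Rightarrow> nat \<Rightarrow> real \<Rightarrow> real" where
  "quant_error \<nu> n r =
     Inf {(\<integral>x. infdist x \<alpha> powr r \<partial>\<nu>) powr (1 / r) | \<alpha>. finite \<alpha> \<and> 1 \<le> card \<alpha> \<and> card \<alpha> \<le> n}"

definition upper_quant_dim :: "(real ^ 'd) measure \<Rightarrow> real \<Rightarrow> ereal" where
  "upper_quant_dim \<nu> r =
     limsup (\<lambda>n. ereal (if quant_error \<nu> n r = 0 then 0
                        else ln (real n) / (- ln (quant_error \<nu> n r))))"

text \<open>The convention \<open>0\<^sup>0 = 0\<close> is built in, since \<open>0 powr q = 0\<close> for every \<open>q\<close>.
  For compactly supported measures only finitely many summands are nonzero.\<close>

definition Lq_spectrum :: "(real ^ 'd) measure \<Rightarrow> real \<Rightarrow> ereal" where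
  "Lq_spectrum \<nu> q =
     limsup (\<lambda>n. ereal (ln (\<Sum>\<^sub>\<infinity>C\<in>dyadic_cubes n. measure \<nu> C powr q) / ln (2 ^ n)))"

definition crit_exponent :: "(real ^ 'd) measure \<Rightarrow> real \<Rightarrow> real" where
  "crit_exponent \<nu> r = Inf {q. q > 0 \<and> Lq_spectrum \<nu> q < ereal (r * q)}"

end

theory Submission
  imports Defs "HOL-Real_Asymp.Real_Asymp"
begin

text \<open>
  If the spectrum at \<open>q < 1\<close> lies below \<open>r q\<close>, the weights
  \<open>J(C) = \<nu>(C) 2\<^bsup>-nr\<^esup>\<close> of the dyadic cubes \<open>C\<close> of level \<open>n\<close> have
  \<open>\<Sum>\<^bsub>C\<^esub> J(C)\<^bsup>q\<^esup>\<close> finite over all levels together. Hence at most a constant times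
  \<open>1 / t\<^bsup>q\<^esup>\<close> cubes have weight at least \<open>t\<close>, and stopping at the first cube of weight
  below \<open>t\<close> gives a quantizer with that many points and error integral
  \<open>O(t\<^bsup>1-q\<^esup>)\<close>, so the upper quantization dimension is at most \<open>r q / (1 - q)\<close>.

  Conversely, let the dimension be less than \<open>s\<close>. Of \<open>N\<close> cubes of level \<open>m\<close>
  with measure at least \<open>t\<close>, a set of \<open>c N\<close> points misses the neighbourhoods of half, so
  \<open>N t 2\<^bsup>-mr\<^esup>\<close> is at most a constant times \<open>N\<^bsup>-r/s\<^esup>\<close>. This weak-type bound sums up,
  with a loss logarithmic in the number of cubes, to a spectrum of at most \<open>r q\<close> at
  \<open>q = s / (r + s)\<close>.

  The remaining claims follow since the spectrum is nonincreasing, vanishes at \<open>1\<close> and is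
  convex on \<open>[0, 1]\<close> by the Hoelder inequality.
\<close>

section \<open>Auxiliary inequalities\<close>

text \<open>Hoelder's inequality with exponents \<open>1/u\<close> and \<open>1/v\<close>. Both sums
  on the right are normalised to 1, after which Young's inequality applies term by term.\<close>

lemma sum_powr_log_convex:
  fixes f :: "'a \<Rightarrow> real"
  assumes "finite A" "A \<noteq> {}" and pos: "\<And>a. a \<in> A \<Longrightarrow> 0 < f a"
    and uv: "0 \<le> u" "0 \<le> v" "u + v = 1"
  shows "(\<Sum>a\<in>A. f a powr (u * p + v * q))
           \<le> (\<Sum>a\<in>A. f a powr p) powr u * (\<Sum>a\<in>A. f a powr q) powr v"
proof -
  define P where "P = (\<Sum>a\<in>A. f a powr p)"
  define Q where "Q = (\<Sum>a\<in>A. f a powr q)"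
  have P: "P > 0" and Q: "Q > 0"
    unfolding P_def Q_def using assms(1,2) by (intro sum_pos; use pos in fastforce)+
  have "(\<Sum>a\<in>A. f a powr (u * p + v * q) / (P powr u * Q powr v))
          \<le> (\<Sum>a\<in>A. u * (f a powr p / P) + v * (f a powr q / Q))"
  proof (rule sum_mono)
    fix a assume "a \<in> A"
    with pos have fa: "f a > 0" by auto
    have "f a powr (u * p + v * q) / (P powr u * Q powr v)
            = (f a powr p / P) powr u * (f a powr q / Q) powr v"
      using fa P Q by (simp add: powr_divide powr_powr powr_add mult.commute)
    also have "\<dots> \<le> u * (f a powr p / P) + v * (f a powr q / Q)"
      using fa P Q uv by (intro Youngs_inequality_0) auto
    finally show "f a powr (u * p + v * q) / (P powr u * Q powr v)
        \<le> u * (f a powr p / P) + v * (f a powr q / Q)" .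
  qed
  also have "\<dots> = u * (P / P) + v * (Q / Q)"
    by (simp add: sum.distrib P_def Q_def flip: sum_distrib_left sum_divide_distrib)
  also have "\<dots> = 1" using P Q uv by simp
  finally show ?thesis
    using P Q by (simp add: field_simps flip: P_def Q_def sum_divide_distrib)
qed

text \<open>Removing a minimiser of \<open>f\<close> preserves the hypothesis, and the minimum itself is at
  most \<open>K / card A\<close>.\<close>

lemma sum_le_harm_if_weak_bound:
  fixes f :: "'a \<Rightarrow> real"
  assumes "finite A" and "\<And>a. a \<in> A \<Longrightarrow> 0 \<le> f a"
    and "\<And>a. a \<in> A \<Longrightarrow> real (card {b \<in> A. f a \<le> f b}) * f a \<le> K"
  shows "sum f A \<le> K * harm (card A)"
  using assms
proof (induction "card A" arbitrary: A)
  case 0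
  then show ?case by (simp add: harm_def)
next
  case (Suc n)
  then have "A \<noteq> {}" by auto
  with Suc.prems(1) obtain a where a: "a \<in> A" "\<And>b. b \<in> A \<Longrightarrow> f a \<le> f b"
    by (metis arg_min_if_finite(1) arg_min_least)
  have "{b \<in> A. f a \<le> f b} = A" using a by auto
  with Suc.prems(3)[OF a(1)] Suc.hyps(2) have fa: "f a \<le> K * inverse (real (Suc n))"
    by (simp add: field_simps)
  have "sum f (A - {a}) \<le> K * harm (card (A - {a}))"
  proof (rule Suc.hyps(1))
    fix c assume c: "c \<in> A - {a}"
    have *: "real (card {b \<in> A. f c \<le> f b}) * f c \<le> K" using Suc.prems(3) c by auto
    have "card {b \<in> A - {a}. f c \<le> f b} \<le> card {b \<in> A. f c \<le> f b}"
      using Suc.prems(1) by (intro card_mono) auto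
    then have "real (card {b \<in> A - {a}. f c \<le> f b}) * f c \<le> real (card {b \<in> A. f c \<le> f b}) * f c"
      using Suc.prems(2) c by (intro mult_right_mono) auto
    with * show "real (card {b \<in> A - {a}. f c \<le> f b}) * f c \<le> K" by linarith
  qed (use Suc a in auto)
  moreover have "sum f A = f a + sum f (A - {a})"
    using Suc.prems(1) a(1) by (simp add: sum.remove)
  moreover have "card (A - {a}) = n" using Suc a by simp
  ultimately show ?case
    using fa unfolding Suc.hyps(2)[symmetric] by (simp add: harm_Suc algebra_simps)
qed

text \<open>Makes the harmonic loss in the weak-type summation logarithmic. The induction step is
  \<open>ln x \<le> x - 1\<close> at \<open>x = n / (n + 1)\<close>.\<close>

lemma harm_le_1_plus_ln: "n \<ge> 1 \<Longrightarrow> harm n \<le> 1 + ln (real n)"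
proof (induction n rule: dec_induct)
  case base
  then show ?case by (simp add: harm_def)
next
  case (step n)
  then have n: "real n > 0" by simp
  have "ln (real n / real (Suc n)) \<le> real n / real (Suc n) - 1"
    using n by (intro ln_le_minus_one) simp
  also have "\<dots> = - inverse (real (Suc n))" by (simp add: field_simps)
  finally have "inverse (real (Suc n)) \<le> ln (real (Suc n)) - ln (real n)"
    using n by (simp add: ln_div)
  with step.IH show ?case by (simp add: harm_Suc)
qed

section \<open>Limits superior of real sequences in the extended reals\<close>

lemma ereal_limsup_le:
  assumes "eventually (\<lambda>n. f n \<le> c) sequentially"
  shows "limsup (\<lambda>n. ereal (f n)) \<le> ereal c"
  using assms by (intro Limsup_bounded) simp

lemma ereal_limsup_ge:
  assumes "eventually (\<lambda>n. c \<le> f n) sequentially"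
  shows "ereal c \<le> limsup (\<lambda>n. ereal (f n))"
  using assms
  by (intro order_trans[OF le_Limsup[of sequentially] order.refl]) auto

lemma ereal_limsup_lessD:
  assumes "limsup (\<lambda>n. ereal (f n)) < ereal c"
  shows "eventually (\<lambda>n. f n < c) sequentially"
  using Limsup_lessD[OF assms] by simp

lemma ereal_limsup_le_lim:
  assumes "eventually (\<lambda>n. f n \<le> g n) sequentially" "g \<longlonglongrightarrow> c"
  shows "limsup (\<lambda>n. ereal (f n)) \<le> ereal c"
proof -
  have "limsup (\<lambda>n. ereal (f n)) \<le> limsup (\<lambda>n. ereal (g n))"
    using assms(1) by (intro Limsup_mono) simp
  also have "\<dots> = ereal c" using assms(2) by (intro lim_imp_Limsup) auto
  finally show ?thesis .
qed

section \<open>Dyadic cubes\<close>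

text \<open>Addressing cubes by integer vectors lets sums run over indices instead of sets and makes
  parents and neighbours a matter of integer arithmetic.\<close>

definition cube :: "nat \<Rightarrow> ('d::finite \<Rightarrow> int) \<Rightarrow> (real ^ 'd) set" where
  "cube n k = {x. \<forall>i. of_int (k i) / 2 ^ n < x $ i \<and> x $ i \<le> (of_int (k i) + 1) / 2 ^ n}"

text \<open>Cubes are open on the left, hence a ceiling minus 1 and not a floor.\<close>

definition cube_index :: "nat \<Rightarrow> real ^ 'd \<Rightarrow> 'd::finite \<Rightarrow> int" where
  "cube_index n x = (\<lambda>i. \<lceil>2 ^ n * x $ i\<rceil> - 1)"

text \<open>The upper corner is the one that belongs to the half-open cube.\<close>

definition cube_corner :: "nat \<Rightarrow> ('d::finite \<Rightarrow> int) \<Rightarrow> real ^ 'd" where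
  "cube_corner n k = (\<chi> i. (of_int (k i) + 1) / 2 ^ n)"

lemma dyadic_cubes_eq: "dyadic_cubes n = range (cube n)"
  by (simp add: dyadic_cubes_def cube_def[abs_def])

lemma mem_cube_iff: "x \<in> cube n k \<longleftrightarrow> cube_index n x = k"
proof -
  have "of_int (k i) / 2 ^ n < x $ i \<and> x $ i \<le> (of_int (k i) + 1) / 2 ^ n
          \<longleftrightarrow> \<lceil>2 ^ n * x $ i\<rceil> - 1 = k i" for i
  proof -
    have "\<lceil>2 ^ n * x $ i\<rceil> - 1 = k i \<longleftrightarrow> \<lceil>2 ^ n * x $ i\<rceil> = k i + 1" by auto
    then show ?thesis unfolding ceiling_eq_iff by (auto simp: field_simps)
  qed
  then show ?thesis by (auto simp: cube_def cube_index_def fun_eq_iff)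
qed

lemma cube_index_corner: "cube_index n (cube_corner n k) = k"
proof -
  have "cube_corner n k \<in> cube n k" by (simp add: cube_def cube_corner_def divide_strict_right_mono)
  then show ?thesis by (simp add: mem_cube_iff)
qed

lemma inj_cube: "inj (cube n)"
  by (rule injI) (metis cube_index_corner mem_cube_iff)

lemma cube_disjoint: "disjoint_family (cube n)"
  by (auto simp: disjoint_family_on_def mem_cube_iff)

lemma cube_borel: "cube n k \<in> sets borel"
proof -
  have "cube n k = (\<Inter>i. {x. of_int (k i) / 2 ^ n < x $ i} \<inter> {x. x $ i \<le> (of_int (k i) + 1) / 2 ^ n})"
    by (auto simp: cube_def)
  moreover have "{x::real^'d. c < x $ i} \<in> sets borel" "{x::real^'d. x $ i \<le> c} \<in> sets borel" for c i
    by (intro borel_open borel_closed open_halfspace_component_gt_cart closed_halfspace_component_le_cart)+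
  ultimately show ?thesis by (auto intro!: sets.Int sets.finite_INT)
qed

text \<open>The parent relation of the dyadic tree.\<close>

lemma cube_index_div2: "cube_index n x i = cube_index (Suc n) x i div 2"
proof -
  define y where "y = 2 ^ n * x $ i"
  have "\<lceil>y\<rceil> - 1 = (\<lceil>2 * y\<rceil> - 1) div 2" by linarith
  then show ?thesis by (simp add: cube_index_def y_def mult.assoc)
qed

text \<open>The constant \<open>CARD('d)\<close> comes from estimating the norm by the sum of the
  coordinates, each at most the side length.\<close>

lemma infdist_cube_corner_le:
  fixes x :: "real ^ 'd"
  assumes "x \<in> cube n k" "cube_corner n k \<in> \<alpha>"
  shows "infdist x \<alpha> \<le> real CARD('d) / 2 ^ n"
proof -
  have "infdist x \<alpha> \<le> dist x (cube_corner n k)" using assms by (intro infdist_le)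
  also have "\<dots> \<le> (\<Sum>i\<in>UNIV. \<bar>(x - cube_corner n k) $ i\<bar>)"
    unfolding dist_norm by (rule norm_le_l1_cart)
  also have "\<dots> \<le> (\<Sum>i\<in>(UNIV::'d set). 1 / 2 ^ n)"
    using assms(1)
    by (intro sum_mono) (auto simp: cube_def cube_corner_def add_divide_distrib abs_le_iff dest!: spec less_imp_le)
  finally show ?thesis by simp
qed

section \<open>Neighbouring cubes and the separation of points\<close>

definition cube_neighbours :: "('d::finite \<Rightarrow> int) \<Rightarrow> ('d \<Rightarrow> int) set" where
  "cube_neighbours k = {l. \<forall>i. \<bar>l i - k i\<bar> \<le> 1}"

lemma finite_bounded_indices:
  fixes a b :: "'d::finite \<Rightarrow> int"
  shows "finite {l. \<forall>i. a i \<le> l i \<and> l i \<le> b i}"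
proof -
  have "{l. \<forall>i. a i \<le> l i \<and> l i \<le> b i} = PiE UNIV (\<lambda>i. {a i..b i})"
    by (auto simp: PiE_UNIV_domain)
  then show ?thesis by (simp add: finite_PiE)
qed

lemma finite_cube_neighbours: "finite (cube_neighbours k)"
proof -
  have "cube_neighbours k = {l. \<forall>i. k i - 1 \<le> l i \<and> l i \<le> k i + 1}"
    by (auto simp: cube_neighbours_def abs_le_iff algebra_simps)
  then show ?thesis by (simp add: finite_bounded_indices)
qed

lemma card_cube_neighbours:
  "card (cube_neighbours (k :: 'd::finite \<Rightarrow> int)) = card (cube_neighbours (\<lambda>_::'d. 0))"
  by (rule bij_betw_same_card[of "\<lambda>l i. l i - k i"], rule bij_betw_byWitness[where f' = "\<lambda>l i. l i + k i"])
     (auto simp: cube_neighbours_def)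

lemma card_cube_neighbours_pos: "card (cube_neighbours k) > 0"
proof -
  have "k \<in> cube_neighbours k" by (simp add: cube_neighbours_def)
  then show ?thesis using finite_cube_neighbours[of k] by (auto simp: card_gt_0_iff)
qed

text \<open>Some coordinate of the indices differs by at least 2, and ceilings that far apart force
  the scaled coordinates apart by at least 1.\<close>

lemma dist_non_neighbours_ge:
  assumes "cube_index n x \<notin> cube_neighbours (cube_index n y)"
  shows "1 / 2 ^ n \<le> dist x y"
proof -
  obtain i where "\<not> \<bar>cube_index n x i - cube_index n y i\<bar> \<le> 1"
    using assms by (auto simp: cube_neighbours_def)
  then have "1 \<le> \<bar>2 ^ n * x $ i - 2 ^ n * y $ i\<bar>" unfolding cube_index_def by linarith
  also have "\<dots> = 2 ^ n * \<bar>(x - y) $ i\<bar>" by (simp add: abs_mult flip: right_diff_distrib)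
  also have "\<dots> \<le> 2 ^ n * dist x y"
    unfolding dist_norm by (intro mult_left_mono component_le_norm_cart) simp
  finally show ?thesis by (simp add: field_simps)
qed

section \<open>The partition functions of a compactly supported measure\<close>

locale compact_prob = prob_space \<nu> for \<nu> :: "(real ^ 'd::finite) measure" +
  assumes sets_eq: "sets \<nu> = sets borel"
    and compact_support: "compact (msupport \<nu>)"
begin

lemma space_eq: "space \<nu> = UNIV"
  using sets_eq_imp_space_eq[OF sets_eq] by simp

text \<open>The complement of the support is a union of open null sets, which the Lindeloef property
  reduces to a countable one.\<close>

lemma AE_in_support: "AE x in \<nu>. x \<in> msupport \<nu>"
proof -
  define F where "F = {U. open U \<and> emeasure \<nu> U = 0}"
  have compl: "- msupport \<nu> = \<Union>F"
    by (auto simp: F_def msupport_def zero_less_iff_neq_zero)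
  obtain F' where F': "F' \<subseteq> F" "countable F'" "\<Union>F' = \<Union>F"
    using Lindelof[of F] by (auto simp: F_def)
  have "\<Union>F' \<in> null_sets \<nu>"
  proof (rule null_sets_UN'[of F' id, simplified])
    show "U \<in> null_sets \<nu>" if "U \<in> F'" for U
      using F'(1) that by (auto simp: F_def null_sets_def sets_eq)
  qed (use F' in auto)
  then have "- msupport \<nu> \<in> null_sets \<nu>" using compl F'(3) by simp
  then show ?thesis by (rule AE_I') auto
qed

lemma cube_sets [measurable]: "cube n k \<in> sets \<nu>"
  by (simp add: sets_eq cube_borel)

text \<open>Null cubes contribute \<open>0 powr q = 0\<close> to the spectrum, so these finitely
  many indices carry the whole partition sum.\<close>

definition pos_cubes :: "nat \<Rightarrow> ('d \<Rightarrow> int) set" where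
  "pos_cubes n = {k. 0 < measure \<nu> (cube n k)}"

definition partition_sum :: "nat \<Rightarrow> real \<Rightarrow> real" where
  "partition_sum n q = (\<Sum>k\<in>pos_cubes n. measure \<nu> (cube n k) powr q)"

lemma AE_cube_index: "AE x in \<nu>. \<forall>n. cube_index n x \<in> pos_cubes n"
proof -
  have "AE x in \<nu>. cube_index n x \<in> pos_cubes n" for n
  proof -
    have "cube n k \<in> null_sets \<nu>" if "k \<notin> pos_cubes n" for k
      using that by (auto simp: pos_cubes_def null_sets_def emeasure_eq_measure zero_less_measure_iff)
    then have "(\<Union>k\<in>-pos_cubes n. cube n k) \<in> null_sets \<nu>"
      by (intro null_sets_UN') auto
    then show ?thesis by (rule AE_I') (auto simp: mem_cube_iff)
  qed
  then show ?thesis by (simp add: AE_all_countable)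
qed

text \<open>A cube of positive measure meets the support, which lies in a box of half-side
  \<open>R\<close>. It remains to count the cubes of level \<open>n\<close> that meet the
  box.\<close>

lemma pos_cubes_bound:
  obtains M :: real where "M \<ge> 1" "\<And>n. finite (pos_cubes n)"
    "\<And>n. real (card (pos_cubes n)) \<le> M * (2 ^ CARD('d)) ^ n"
proof -
  obtain B where B: "\<And>x. x \<in> msupport \<nu> \<Longrightarrow> norm x \<le> B"
    using compact_imp_bounded[OF compact_support] by (auto simp: bounded_iff)
  define R :: nat where "R = nat \<lceil>B\<rceil> + 1"
  have R: "\<bar>x $ i\<bar> \<le> real R" if "x \<in> msupport \<nu>" for x i
    using B[OF that] component_le_norm_cart[of x i] unfolding R_def by linarith
  \<comment> \<open>The extra \<open>- 1\<close> at the lower end is the shift in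
    \<open>cube_index\<close>.\<close>
  define K where "K n = PiE (UNIV :: 'd set) (\<lambda>_. {- (int R * 2 ^ n) - 1 .. int R * 2 ^ n})" for n
  have sub: "pos_cubes n \<subseteq> K n" for n
  proof
    fix k assume k: "k \<in> pos_cubes n"
    have "\<exists>x \<in> cube n k. x \<in> msupport \<nu>"
    proof (rule ccontr)
      assume "\<not> ?thesis"
      then have "AE x in \<nu>. x \<notin> cube n k" using AE_in_support by (auto elim!: eventually_mono)
      then have "measure \<nu> (cube n k) = 0"
        by (subst (asm) AE_iff_measurable[OF cube_sets]) (auto simp: space_eq measure_def)
      with k show False by (simp add: pos_cubes_def)
    qed
    then obtain x where x: "cube_index n x = k" "x \<in> msupport \<nu>" by (auto simp: mem_cube_iff)
    have "k i \<in> {- (int R * 2 ^ n) - 1 .. int R * 2 ^ n}" for i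
    proof -
      have "\<bar>2 ^ n * x $ i\<bar> \<le> 2 ^ n * real R"
        using R[OF x(2), of i] by (simp add: abs_mult)
      also have "\<dots> = real_of_int (int R * 2 ^ n)" by simp
      finally have "\<bar>2 ^ n * x $ i\<bar> \<le> real_of_int (int R * 2 ^ n)" .
      then have "k i \<ge> - (int R * 2 ^ n) - 1 \<and> k i \<le> int R * 2 ^ n"
        unfolding x(1)[symmetric] cube_index_def by linarith
      then show ?thesis by simp
    qed
    then show "k \<in> K n" by (auto simp: K_def)
  qed
  have fin: "finite (K n)" for n unfolding K_def by (intro finite_PiE) auto
  have "real (card (K n)) \<le> (2 * R + 2) ^ CARD('d) * (2 ^ CARD('d)) ^ n" for n
  proof -
    have "card (K n) = nat (2 * int R * 2 ^ n + 2) ^ CARD('d)"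
      unfolding K_def by (subst card_PiE) (auto simp: algebra_simps)
    also have "nat (2 * int R * 2 ^ n + 2) = 2 * R * 2 ^ n + 2"
      by (simp add: nat_add_distrib nat_mult_distrib nat_power_eq)
    also have "\<dots> ^ CARD('d) \<le> ((2 * R + 2) * 2 ^ n) ^ CARD('d)"
      by (intro power_mono) (auto simp: algebra_simps)
    also have "\<dots> = (2 * R + 2) ^ CARD('d) * (2 ^ CARD('d)) ^ n"
      by (simp only: power_mult_distrib power_mult[symmetric] mult.commute)
    finally show ?thesis by (simp only: of_nat_le_iff)
  qed
  moreover have "card (pos_cubes n) \<le> card (K n)" for n
    using sub fin by (intro card_mono)
  ultimately have "real (card (pos_cubes n)) \<le> real ((2 * R + 2) ^ CARD('d)) * (2 ^ CARD('d)) ^ n" for n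
    by (metis (no_types, lifting) of_nat_le_iff of_nat_mult of_nat_numeral of_nat_power order_trans)
  moreover have "finite (pos_cubes n)" for n using sub fin by (rule finite_subset)
  moreover have "1 \<le> real ((2 * R + 2) ^ CARD('d))"
    unfolding of_nat_power by (intro one_le_power) simp
  ultimately show ?thesis using that by blast
qed

lemma finite_pos_cubes: "finite (pos_cubes n)"
  using pos_cubes_bound by metis

lemma measure_cube_pos: "k \<in> pos_cubes n \<Longrightarrow> 0 < measure \<nu> (cube n k)"
  by (simp add: pos_cubes_def)

lemma sum_measure_pos_cubes: "(\<Sum>k\<in>pos_cubes n. measure \<nu> (cube n k)) = 1"
proof -
  have "(\<Sum>k\<in>pos_cubes n. measure \<nu> (cube n k)) = measure \<nu> (\<Union>k\<in>pos_cubes n. cube n k)"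
    using cube_disjoint[of n]
    by (intro finite_measure_finite_Union[symmetric] finite_pos_cubes)
       (auto intro: disjoint_family_on_mono)
  also have "\<dots> = 1"
    using AE_cube_index finite_pos_cubes
    by (intro prob_eq_1[THEN iffD2]) (auto simp: mem_cube_iff elim!: eventually_mono)
  finally show ?thesis .
qed

lemma pos_cubes_nonempty: "pos_cubes n \<noteq> {}"
  using sum_measure_pos_cubes[of n] by auto

section \<open>Values, monotonicity, finiteness and convexity of the spectrum\<close>

lemma Lq_spectrum_eq:
  "Lq_spectrum \<nu> q = limsup (\<lambda>n. ereal (ln (partition_sum n q) / ln (2 ^ n)))"
proof -
  have "(\<Sum>\<^sub>\<infinity>C\<in>dyadic_cubes n. measure \<nu> C powr q) = partition_sum n q" for n
  proof -
    have "(\<Sum>\<^sub>\<infinity>C\<in>dyadic_cubes n. measure \<nu> C powr q) = (\<Sum>\<^sub>\<infinity>k. measure \<nu> (cube n k) powr q)"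
      unfolding dyadic_cubes_eq by (subst infsum_reindex[OF inj_cube]) (simp add: o_def)
    also have "\<dots> = (\<Sum>\<^sub>\<infinity>k\<in>pos_cubes n. measure \<nu> (cube n k) powr q)"
      by (intro infsum_cong_neutral) (auto simp: pos_cubes_def zero_less_measure_iff)
    finally show ?thesis by (simp add: partition_sum_def infsum_finite finite_pos_cubes)
  qed
  then show ?thesis by (simp add: Lq_spectrum_def)
qed

lemma partition_sum_antimono:
  assumes "p \<le> q"
  shows "partition_sum n q \<le> partition_sum n p"
  unfolding partition_sum_def
  using assms by (intro sum_mono powr_mono') (auto simp: measure_cube_pos less_imp_le)

lemma partition_sum_1: "partition_sum n 1 = 1"
  using sum_measure_pos_cubes[of n] by (simp add: partition_sum_def measure_cube_pos less_imp_le)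

lemma partition_sum_0: "partition_sum n 0 = card (pos_cubes n)"
proof -
  have "partition_sum n 0 = (\<Sum>k\<in>pos_cubes n. 1)"
    unfolding partition_sum_def by (intro sum.cong) (auto dest: measure_cube_pos)
  then show ?thesis by simp
qed

lemma partition_sum_pos: "0 < partition_sum n q"
  unfolding partition_sum_def using pos_cubes_nonempty[of n] finite_pos_cubes[of n]
  by (intro sum_pos) (auto dest: measure_cube_pos)

lemma Lq_spectrum_antimono:
  assumes "p \<le> q"
  shows "Lq_spectrum \<nu> q \<le> Lq_spectrum \<nu> p"
  unfolding Lq_spectrum_eq
  by (intro Limsup_mono always_eventually allI)
     (use assms in \<open>auto intro!: divide_right_mono ln_mono partition_sum_antimono partition_sum_pos\<close>)

lemma Lq_spectrum_1: "Lq_spectrum \<nu> 1 = 0"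
  by (simp add: Lq_spectrum_eq partition_sum_1 Limsup_const flip: zero_ereal_def)

lemma Lq_spectrum_nonneg: "q \<le> 1 \<Longrightarrow> 0 \<le> Lq_spectrum \<nu> q"
  using Lq_spectrum_antimono[of q 1] by (simp add: Lq_spectrum_1)

lemma Lq_spectrum_0_finite: "Lq_spectrum \<nu> 0 < \<infinity>"
proof -
  obtain M where M: "M \<ge> 1" "\<And>n. real (card (pos_cubes n)) \<le> M * (2 ^ CARD('d)) ^ n"
    using pos_cubes_bound by metis
  have "Lq_spectrum \<nu> 0 \<le> ereal (ln M / ln 2 + real CARD('d))"
    unfolding Lq_spectrum_eq
  proof (rule ereal_limsup_le, rule eventually_sequentiallyI[of 1])
    fix n :: nat assume n: "1 \<le> n"
    have "ln (partition_sum n 0) \<le> ln (M * (2 ^ CARD('d)) ^ n)"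
      using M(2)[of n] partition_sum_pos[of n 0] by (simp add: partition_sum_0)
    also have "\<dots> = ln M + real n * (real CARD('d) * ln 2)"
      using M(1) by (simp add: ln_mult ln_realpow)
    also have "\<dots> \<le> real n * ln M + real n * (real CARD('d) * ln 2)"
      using n M(1) mult_right_mono[of 1 "real n" "ln M"] by simp
    also have "\<dots> = (ln M / ln 2 + real CARD('d)) * ln (2 ^ n)"
      by (simp add: ln_realpow field_simps)
    finally show "ln (partition_sum n 0) / ln (2 ^ n) \<le> ln M / ln 2 + real CARD('d)"
      using n by (simp add: divide_le_eq)
  qed
  then show ?thesis by auto
qed

text \<open>Infinite values would be sent to 0, so this is used only on \<open>[0, 1]\<close>, where
  the spectrum is finite.\<close>

definition \<beta> :: "real \<Rightarrow> real" where
  "\<beta> q = real_of_ereal (Lq_spectrum \<nu> q)"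

lemma Lq_spectrum_real:
  assumes "0 \<le> q" "q \<le> 1"
  shows "Lq_spectrum \<nu> q = ereal (\<beta> q)"
proof -
  have "Lq_spectrum \<nu> q < \<infinity>"
    using Lq_spectrum_antimono[OF assms(1)] Lq_spectrum_0_finite by (rule le_less_trans)
  with Lq_spectrum_nonneg[OF assms(2)] show ?thesis
    unfolding \<beta>_def by (cases "Lq_spectrum \<nu> q") auto
qed

text \<open>By Hoelder the logarithm of each partition sum is convex in the exponent. The slack
  \<open>e\<close> carries this over to the limit superior.\<close>

lemma convex_on_\<beta>: "convex_on {0..1} \<beta>"
proof (rule convex_onI)
  fix t p q :: real
  assume t: "0 < t" "t < 1" and p: "p \<in> {0..1}" and q: "q \<in> {0..1}"
  define x where "x = (1 - t) * p + t * q"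
  have "x \<in> {0..1}" using t p q convexD[of "{0..1::real}" p q "1 - t" t] by (simp add: x_def)
  then have x: "Lq_spectrum \<nu> x = ereal (\<beta> x)" by (simp add: Lq_spectrum_real)
  have "\<beta> x \<le> ((1 - t) * \<beta> p + t * \<beta> q) + e" if e: "e > 0" for e
  proof -
    have "Lq_spectrum \<nu> p < ereal (\<beta> p + e)" "Lq_spectrum \<nu> q < ereal (\<beta> q + e)"
      using p q e by (simp_all add: Lq_spectrum_real)
    then have "\<forall>\<^sub>F n in sequentially. ln (partition_sum n p) / ln (2 ^ n) < \<beta> p + e"
      "\<forall>\<^sub>F n in sequentially. ln (partition_sum n q) / ln (2 ^ n) < \<beta> q + e"
      unfolding Lq_spectrum_eq by (auto dest: ereal_limsup_lessD)
    then have "\<forall>\<^sub>F n in sequentially. ln (partition_sum n x) / ln (2 ^ n)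
                 \<le> (1 - t) * (\<beta> p + e) + t * (\<beta> q + e)"
    proof eventually_elim
      case (elim n)
      have "partition_sum n x \<le> partition_sum n p powr (1 - t) * partition_sum n q powr t"
        unfolding partition_sum_def x_def using t finite_pos_cubes pos_cubes_nonempty
        by (intro sum_powr_log_convex) (auto dest: measure_cube_pos)
      then have "ln (partition_sum n x) \<le> ln (partition_sum n p powr (1 - t) * partition_sum n q powr t)"
        using partition_sum_pos by (intro ln_mono) auto
      also have "\<dots> = (1 - t) * ln (partition_sum n p) + t * ln (partition_sum n q)"
        using partition_sum_pos[of n p] partition_sum_pos[of n q] by (simp add: ln_mult ln_powr)
      finally have "ln (partition_sum n x) / ln (2 ^ n)
          \<le> ((1 - t) * ln (partition_sum n p) + t * ln (partition_sum n q)) / ln (2 ^ n)"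
        by (intro divide_right_mono) auto
      also have "\<dots> = (1 - t) * (ln (partition_sum n p) / ln (2 ^ n))
                    + t * (ln (partition_sum n q) / ln (2 ^ n))"
        by (simp add: add_divide_distrib)
      also have "\<dots> \<le> (1 - t) * (\<beta> p + e) + t * (\<beta> q + e)"
        using elim t by (intro add_mono mult_left_mono) auto
      finally show ?case .
    qed
    then have "Lq_spectrum \<nu> x \<le> ereal ((1 - t) * (\<beta> p + e) + t * (\<beta> q + e))"
      unfolding Lq_spectrum_eq by (rule ereal_limsup_le)
    then show ?thesis unfolding x by (simp add: algebra_simps)
  qed
  then show "\<beta> ((1 - t) *\<^sub>R p + t *\<^sub>R q) \<le> (1 - t) * \<beta> p + t * \<beta> q"
    unfolding x_def real_scaleR_def by (rule field_le_epsilon)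
qed simp

lemma continuous_on_\<beta>: "continuous_on {0<..<1} \<beta>"
  using convex_on_\<beta> by (intro convex_on_continuous) (auto intro: convex_on_subset)

text \<open>The chord over \<open>[0, 1]\<close>, as the spectrum vanishes at 1.\<close>

lemma \<beta>_le: "0 \<le> q \<Longrightarrow> q \<le> 1 \<Longrightarrow> \<beta> q \<le> (1 - q) * \<beta> 0"
  using convex_onD[OF convex_on_\<beta>, of q 0 1] by (simp add: \<beta>_def Lq_spectrum_1)

section \<open>Quantization errors\<close>

text \<open>On the compact support the distance to a fixed point of \<open>\<alpha>\<close> is
  bounded. Hence the integrals in \<open>quant_error\<close> are genuine and not the default
  0.\<close>

lemma integrable_infdist_powr:
  assumes "\<alpha> \<noteq> {}" "0 < r"
  shows "integrable \<nu> (\<lambda>x. infdist x \<alpha> powr r)"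
proof -
  obtain y where y: "y \<in> \<alpha>" using assms(1) by auto
  obtain B where B: "\<And>x. x \<in> msupport \<nu> \<Longrightarrow> norm x \<le> B"
    using compact_imp_bounded[OF compact_support] by (auto simp: bounded_iff)
  have meas: "(\<lambda>x. infdist x \<alpha> powr r) \<in> borel_measurable \<nu>"
    unfolding measurable_cong_sets[OF sets_eq refl]
    by (intro powr_real_measurable borel_measurable_continuous_onI continuous_intros)
  have "norm (infdist x \<alpha> powr r) \<le> (B + norm y) powr r" if "x \<in> msupport \<nu>" for x
  proof -
    have "infdist x \<alpha> \<le> dist x y" using y by (rule infdist_le)
    also have "\<dots> \<le> norm x + norm y" by (simp add: dist_norm norm_triangle_ineq4)
    also have "\<dots> \<le> B + norm y" using B[OF that] by simp
    finally show ?thesis using assms(2) by (auto intro!: powr_mono2 infdist_nonneg)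
  qed
  then show ?thesis
    using AE_in_support by (intro integrable_const_bound[OF _ meas]) (auto elim: eventually_mono)
qed

lemma quant_error_le:
  assumes "finite \<alpha>" "\<alpha> \<noteq> {}" "card \<alpha> \<le> n"
  shows "quant_error \<nu> n r \<le> (\<integral>x. infdist x \<alpha> powr r \<partial>\<nu>) powr (1 / r)"
  unfolding quant_error_def using assms
  by (intro cInf_lower bdd_belowI[of _ 0]) (auto simp: Suc_le_eq card_gt_0_iff)

lemma quant_error_candidates_nonempty:
  assumes "n \<ge> 1"
  shows "{(\<integral>x. infdist x \<alpha> powr r \<partial>\<nu>) powr (1 / r) | \<alpha>. finite \<alpha> \<and> 1 \<le> card \<alpha> \<and> card \<alpha> \<le> n} \<noteq> {}"
  using assms by (auto intro!: exI[of _ "{0}"])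

lemma quant_error_nonneg: "n \<ge> 1 \<Longrightarrow> 0 \<le> quant_error \<nu> n r"
  unfolding quant_error_def by (intro cInf_greatest quant_error_candidates_nonempty) auto

lemma quant_error_lessD:
  assumes "quant_error \<nu> n r < e" "n \<ge> 1"
  obtains \<alpha> where "finite \<alpha>" "\<alpha> \<noteq> {}" "card \<alpha> \<le> n"
    "(\<integral>x. infdist x \<alpha> powr r \<partial>\<nu>) powr (1 / r) < e"
proof -
  obtain y where "y \<in> {(\<integral>x. infdist x \<alpha> powr r \<partial>\<nu>) powr (1 / r) | \<alpha>. finite \<alpha> \<and> 1 \<le> card \<alpha> \<and> card \<alpha> \<le> n}"
    and "y < e"
    using cInf_lessD[OF quant_error_candidates_nonempty[OF assms(2)] assms(1)[unfolded quant_error_def]]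
    by blast
  then obtain \<alpha> where "finite \<alpha>" "1 \<le> card \<alpha>" "card \<alpha> \<le> n"
    "(\<integral>x. infdist x \<alpha> powr r \<partial>\<nu>) powr (1 / r) < e"
    by blast
  then show ?thesis using that[of \<alpha>] by force
qed

section \<open>Upper bound for the quantization dimension\<close>

lemma summable_weighted_partition_sum:
  assumes "Lq_spectrum \<nu> q < ereal (r * q)"
  shows "summable (\<lambda>n. ((1 / 2 ^ n) powr r) powr q * partition_sum n q)"
proof -
  \<comment> \<open>Room between the spectrum and the line yields a geometric majorant of ratio
    \<open>2 powr (b - r * q)\<close>.\<close>
  obtain b where b: "Lq_spectrum \<nu> q < ereal b" "b < r * q"
    using ereal_dense2[OF assms] by auto
  have "\<forall>\<^sub>F n in sequentially. ln (partition_sum n q) / ln (2 ^ n) < b"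
    using b(1) unfolding Lq_spectrum_eq by (rule ereal_limsup_lessD)
  then have "\<forall>\<^sub>F n in sequentially.
      norm (((1 / 2 ^ n) powr r) powr q * partition_sum n q) \<le> (2 powr (b - r * q)) ^ n"
    using eventually_ge_at_top[of 1]
  proof eventually_elim
    case (elim n)
    then have "ln (partition_sum n q) < b * ln (2 ^ n)" by (simp add: divide_less_eq)
    also have "\<dots> = ln (2 powr (b * n))" by (simp add: ln_powr ln_realpow)
    finally have "partition_sum n q < 2 powr (b * n)"
      using partition_sum_pos[of n q] by (subst (asm) ln_less_cancel_iff) auto
    moreover have "((1 / 2 ^ n) powr r) powr q = 2 powr (- (r * q) * n)"
      by (simp add: powr_powr powr_divide powr_minus_divide flip: powr_realpow) (simp add: ac_simps)
    ultimately have "((1 / 2 ^ n) powr r) powr q * partition_sum n q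
        \<le> 2 powr (- (r * q) * n) * 2 powr (b * n)"
      using partition_sum_pos[of n q] by (intro mult_mono) auto
    also have "\<dots> = (2 powr (b - r * q)) ^ n"
      by (simp add: powr_realpow[symmetric] powr_powr powr_add[symmetric] algebra_simps)
    finally show ?case using partition_sum_pos[of n q] by simp
  qed
  moreover have "summable (\<lambda>n. (2 powr (b - r * q)) ^ n)"
    using b(2) by (intro summable_geometric) (simp add: powr_less_one)
  ultimately show ?thesis by (rule summable_comparison_test_ev)
qed

text \<open>Give a cube of level \<open>n\<close> the weight \<open>J n k\<close>, its measure times
  \<open>2\<close> to the power \<open>-n r\<close>. The quantizer consists of a corner of every unit cube of
  positive measure and of every child of a cube of weight at least \<open>t\<close>. Following a point
  down the dyadic tree, the first cube of weight below \<open>t\<close> has its corner in this set.\<close>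

lemma stopping_quantizer:
  assumes "0 < r" "0 < q" "Lq_spectrum \<nu> q < ereal (r * q)"
  obtains c C :: real where "c \<ge> 1" "C > 0" and
    "\<And>t. 0 < t \<Longrightarrow> t \<le> 1 \<Longrightarrow> \<exists>\<alpha>. finite \<alpha> \<and> \<alpha> \<noteq> {} \<and> real (card \<alpha>) \<le> c * t powr (- q)
        \<and> (\<integral>x. infdist x \<alpha> powr r \<partial>\<nu>) \<le> C * t powr (1 - q)"
proof -
  define w where "w n = (1 / 2 ^ n :: real) powr r" for n :: nat
  define J where "J n k = measure \<nu> (cube n k) * w n" for n k
  define A where "A = (\<Sum>n. w n powr q * partition_sum n q)"
  \<comment> \<open>The offsets of the children of a cube: child indices are
    \<open>2 * k + e\<close>.\<close>
  define V where "V = {e :: 'd \<Rightarrow> int. \<forall>i. 0 \<le> e i \<and> e i \<le> 1}"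
  \<comment> \<open>Unit cubes, plus \<open>card V\<close> children for each of the at most
    \<open>A * t powr (- q)\<close> cubes of weight at least \<open>t\<close>.\<close>
  define c where "c = real (card (pos_cubes 0)) + A * real (card V)"
  define C where "C = real CARD('d) powr r * c"
  have summ: "summable (\<lambda>n. w n powr q * partition_sum n q)"
    unfolding w_def using assms(3) by (rule summable_weighted_partition_sum)
  have A: "A \<ge> 0" unfolding A_def
    using partition_sum_pos by (intro suminf_nonneg[OF summ]) (auto simp: less_imp_le)
  have w: "w n > 0" "w n \<le> 1" for n
    using assms(1) unfolding w_def by (auto intro!: powr_le1)
  have w_lim: "w \<longlonglongrightarrow> 0"
    unfolding w_def using assms(1) by real_asymp
  have finV: "finite V" unfolding V_def by (rule finite_bounded_indices)
  have "card (pos_cubes 0) \<ge> 1"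
    using pos_cubes_nonempty finite_pos_cubes by (simp add: Suc_le_eq card_gt_0_iff)
  then have c: "c \<ge> 1" using A by (simp add: c_def add_increasing2)
  show ?thesis
  proof (rule that[of c C])
    show "c \<ge> 1" by fact
    then show "C > 0" by (simp add: C_def)
    fix t :: real assume t: "0 < t" "t \<le> 1"
    define G where "G = {(n, k). t \<le> J n k}"
    define Q where "Q = {0} \<times> pos_cubes 0 \<union> (\<lambda>((n, k), e). (Suc n, \<lambda>i. 2 * k i + e i)) ` (G \<times> V)"
    define \<alpha> where "\<alpha> = (\<lambda>(n, k). cube_corner n k) ` Q"
    define Q' where "Q' = {(n, k) \<in> Q. J n k < t}"
    \<comment> \<open>From level \<open>L\<close> on every weight is below \<open>t\<close>. So
      \<open>G\<close> is finite and every descent stops.\<close>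
    obtain L where L: "\<And>n. n \<ge> L \<Longrightarrow> w n < t"
      using order_tendstoD(2)[OF w_lim t(1)] by (auto simp: eventually_sequentially)
    have J_le: "J n k \<le> w n" for n k
      unfolding J_def using w(1)[of n] by (simp add: mult_left_le_one_le)
    have G_sub: "G \<subseteq> (SIGMA n:{..<L}. pos_cubes n)"
    proof safe
      fix n k assume "(n, k) \<in> G"
      then have J: "t \<le> J n k" by (simp add: G_def)
      show "n < L" using J J_le[of n k] L[of n] by (cases "n < L") auto
      have "0 < measure \<nu> (cube n k) * w n" using J t(1) unfolding J_def by linarith
      then show "k \<in> pos_cubes n" using w(1)[of n] by (simp add: pos_cubes_def zero_less_mult_iff)
    qed
    have fin: "finite (SIGMA n:{..<L}. pos_cubes n)"
      using finite_pos_cubes by auto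
    have finG: "finite G" using G_sub fin by (rule finite_subset)
    have finQ: "finite Q" unfolding Q_def using finG finV finite_pos_cubes by auto
    \<comment> \<open>A Chebyshev count: each member of \<open>G\<close> contributes at least 1 to
      the sum of \<open>(J n k / t) powr q\<close>.\<close>
    have "real (card G) = (\<Sum>(n, k)\<in>G. 1)" by simp
    also have "\<dots> \<le> (\<Sum>(n, k)\<in>G. (J n k / t) powr q)"
      using t assms(2) by (intro sum_mono) (auto simp: G_def intro!: ge_one_powr_ge_zero)
    also have "\<dots> \<le> (\<Sum>(n, k)\<in>(SIGMA n:{..<L}. pos_cubes n). (J n k / t) powr q)"
      using G_sub fin by (intro sum_mono2) auto
    also have "\<dots> = (\<Sum>n<L. \<Sum>k\<in>pos_cubes n. (J n k / t) powr q)"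
      using finite_pos_cubes by (subst sum.Sigma) auto
    also have "\<dots> = (\<Sum>n<L. w n powr q * partition_sum n q) * t powr (- q)"
      unfolding J_def partition_sum_def sum_distrib_left sum_distrib_right using t w
      by (intro sum.cong refl) (simp add: powr_mult powr_divide powr_minus_divide less_imp_le)
    also have "\<dots> \<le> A * t powr (- q)"
      unfolding A_def using partition_sum_pos
      by (intro mult_right_mono sum_le_suminf[OF summ]) (auto simp: less_imp_le)
    finally have cardG: "real (card G) \<le> A * t powr (- q)" .
    have tq: "1 \<le> t powr (- q)"
      using t assms(2) powr_mono'[of "-q" 0 t] by simp
    have "card Q \<le> card ({0::nat} \<times> pos_cubes 0) + card ((\<lambda>((n, k), e). (Suc n, \<lambda>i. 2 * k i + e i)) ` (G \<times> V))"
      unfolding Q_def by (rule card_Un_le)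
    also have "\<dots> \<le> card (pos_cubes 0) + card G * card V"
      using card_image_le[of "G \<times> V" "(\<lambda>((n, k), e). (Suc n, \<lambda>i. 2 * k i + e i))"] finG finV
      by (auto simp: card_cartesian_product)
    finally have "real (card Q) \<le> real (card (pos_cubes 0)) + real (card G) * real (card V)"
      by (simp flip: of_nat_mult of_nat_add)
    also have "\<dots> \<le> real (card (pos_cubes 0)) * t powr (- q) + A * t powr (- q) * real (card V)"
      using cardG tq mult_left_mono[OF tq, of "real (card (pos_cubes 0))"]
      by (intro add_mono mult_right_mono) auto
    finally have cardQ: "real (card Q) \<le> c * t powr (- q)" by (simp add: c_def algebra_simps)

    have fin\<alpha>: "finite \<alpha>" unfolding \<alpha>_def using finQ by simp
    have ne: "\<alpha> \<noteq> {}" unfolding \<alpha>_def Q_def using pos_cubes_nonempty[of 0] by auto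
    have "real (card \<alpha>) \<le> real (card Q)" unfolding \<alpha>_def using finQ by (simp add: card_image_le)
    with cardQ have card\<alpha>: "real (card \<alpha>) \<le> c * t powr (- q)" by simp
    have finQ': "finite Q'" unfolding Q'_def using finQ by (auto intro: finite_subset)
    \<comment> \<open>A simple function dominating the integrand almost everywhere. Each cube of
      \<open>Q'\<close> adds less than \<open>CARD('d) powr r * t\<close> to its integral.\<close>
    define h where "h x = (\<Sum>(n, k)\<in>Q'. indicator (cube n k) x * (real CARD('d) powr r * w n))" for x
    have int_h: "integrable \<nu> h"
      unfolding h_def split_beta
      by (intro Bochner_Integration.integrable_sum integrable_mult_left integrable_real_indicator)
         (auto simp: emeasure_eq_measure)
    have le_h: "infdist x \<alpha> powr r \<le> h x" if x: "\<And>n. cube_index n x \<in> pos_cubes n" for x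
    proof -
      define m where "m = (LEAST n. J n (cube_index n x) < t)"
      have "J L (cube_index L x) < t" using J_le L[of L] by (rule le_less_trans) simp
      then have m: "J m (cube_index m x) < t" unfolding m_def by (rule LeastI)
      have "(m, cube_index m x) \<in> Q"
      proof (cases m)
        case 0
        then show ?thesis using x by (simp add: Q_def)
      next
        case (Suc n)
        then have "\<not> J n (cube_index n x) < t"
          unfolding m_def by (intro not_less_Least) simp
        then have G: "(n, cube_index n x) \<in> G" by (simp add: G_def)
        define e where "e i = cube_index m x i mod 2" for i
        have "e \<in> V" by (auto simp: V_def e_def)
        moreover have "cube_index m x = (\<lambda>i. 2 * cube_index n x i + e i)"
          unfolding Suc cube_index_div2[of n x] e_def by (simp add: fun_eq_iff)
        ultimately show ?thesis using G unfolding Q_def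
          by (intro UnI2 image_eqI[of _ _ "((n, cube_index n x), e)"]) (auto simp: Suc)
      qed
      with m have Q': "(m, cube_index m x) \<in> Q'" "cube_corner m (cube_index m x) \<in> \<alpha>"
        by (force simp: Q'_def \<alpha>_def)+
      have "infdist x \<alpha> powr r \<le> (real CARD('d) / 2 ^ m) powr r"
        using assms(1) Q'(2)
        by (intro powr_mono2 infdist_cube_corner_le[of _ _ "cube_index m x"]) (auto simp: infdist_nonneg mem_cube_iff)
      also have "\<dots> = real CARD('d) powr r * w m"
        by (simp add: w_def powr_divide)
      also have "\<dots> = (case (m, cube_index m x) of (n, k) \<Rightarrow>
          indicator (cube n k) x * (real CARD('d) powr r * w n))" by (simp add: mem_cube_iff)
      also have "\<dots> \<le> h x"
        unfolding h_def using Q'(1) finQ' w(1) by (intro member_le_sum) (auto simp: less_imp_le)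
      finally show ?thesis .
    qed
    have "(\<integral>x. infdist x \<alpha> powr r \<partial>\<nu>) \<le> (\<integral>x. h x \<partial>\<nu>)"
      using AE_cube_index le_h
      by (intro integral_mono_AE integrable_infdist_powr int_h ne assms(1)) (auto elim!: eventually_mono)
    also have "\<dots> = (\<Sum>(n, k)\<in>Q'. real CARD('d) powr r * J n k)"
      unfolding h_def by (subst Bochner_Integration.integral_sum)
        (auto simp: split_beta J_def mult_ac emeasure_eq_measure)
    also have "\<dots> \<le> (\<Sum>(n, k)\<in>Q'. real CARD('d) powr r * t)"
      by (intro sum_mono) (auto simp: Q'_def)
    also have "\<dots> = real (card Q') * (real CARD('d) powr r * t)" by simp
    also have "\<dots> \<le> c * t powr (- q) * (real CARD('d) powr r * t)"
    proof (intro mult_right_mono)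
      have "card Q' \<le> card Q" using finQ by (intro card_mono) (auto simp: Q'_def)
      with cardQ show "real (card Q') \<le> c * t powr (- q)" by linarith
    qed (use t in auto)
    also have "\<dots> = C * t powr (1 - q)"
      using t powr_add[of t 1 "- q"] by (simp add: C_def)
    finally show "\<exists>\<alpha>. finite \<alpha> \<and> \<alpha> \<noteq> {} \<and> real (card \<alpha>) \<le> c * t powr (- q)
        \<and> (\<integral>x. infdist x \<alpha> powr r \<partial>\<nu>) \<le> C * t powr (1 - q)"
      using fin\<alpha> ne card\<alpha> by blast
  qed
qed

lemma quant_error_power_bound:
  assumes "0 < r" "0 < q" "q < 1" "Lq_spectrum \<nu> q < ereal (r * q)"
  obtains c :: real where "c > 0"
    "\<forall>\<^sub>F n in sequentially. quant_error \<nu> n r \<le> c * real n powr (- ((1 - q) / (r * q)))"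
proof -
  obtain c C :: real where cC: "c \<ge> 1" "C > 0" and ex:
    "\<And>t. 0 < t \<Longrightarrow> t \<le> 1 \<Longrightarrow> \<exists>\<alpha>. finite \<alpha> \<and> \<alpha> \<noteq> {} \<and> real (card \<alpha>) \<le> c * t powr (- q)
        \<and> (\<integral>x. infdist x \<alpha> powr r \<partial>\<nu>) \<le> C * t powr (1 - q)"
    using stopping_quantizer[OF assms(1,2,4)] by blast
  define a where "a = (1 - q) / (r * q)"
  define c' where "c' = C powr (1 / r) * c powr a"
  have "quant_error \<nu> n r \<le> c' * real n powr (- a)" if n: "n \<ge> nat \<lceil>c\<rceil>" for n
  proof -
    have n: "real n \<ge> c" "real n > 0" using n cC(1) by linarith+
    \<comment> \<open>The threshold at which the cardinality bound \<open>c * t powr (- q)\<close>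
      equals \<open>n\<close>; it is at most 1 because \<open>n \<ge> c\<close>.\<close>
    define t where "t = (c / real n) powr (1 / q)"
    have t: "0 < t" "t \<le> 1"
      unfolding t_def using n cC(1) assms(2) by (auto intro!: powr_le1)
    obtain \<alpha> where \<alpha>: "finite \<alpha>" "\<alpha> \<noteq> {}" "real (card \<alpha>) \<le> c * t powr (- q)"
      "(\<integral>x. infdist x \<alpha> powr r \<partial>\<nu>) \<le> C * t powr (1 - q)" using ex[OF t] by blast
    have "c * t powr (- q) = real n"
      unfolding t_def powr_powr using assms(2) n cC(1) by (simp add: powr_minus)
    with \<alpha>(3) have "card \<alpha> \<le> n" by simp
    then have "quant_error \<nu> n r \<le> (\<integral>x. infdist x \<alpha> powr r \<partial>\<nu>) powr (1 / r)"
      using \<alpha> by (intro quant_error_le)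
    also have "\<dots> \<le> (C * t powr (1 - q)) powr (1 / r)"
      using \<alpha>(4) assms(1) by (intro powr_mono2) auto
    also have "\<dots> = C powr (1 / r) * (c / real n) powr a"
      unfolding t_def using cC assms by (simp add: powr_mult powr_powr a_def mult.commute)
    also have "\<dots> = c' * real n powr (- a)"
      using n cC(1) by (simp add: c'_def powr_divide powr_minus_divide)
    finally show ?thesis .
  qed
  then show ?thesis
    using cC unfolding a_def
    by (intro that[of c'] eventually_sequentiallyI[of "nat \<lceil>c\<rceil>"]) (auto simp: c'_def)
qed

text \<open>Taking logarithms in the power bound of exponent \<open>- a\<close> leaves a quotient
  tending to \<open>1 / a\<close>. Vanishing errors enter as 0 by convention.\<close>

lemma upper_quant_dim_le:
  assumes "0 < r" "0 < q" "q < 1" "Lq_spectrum \<nu> q < ereal (r * q)"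
  shows "upper_quant_dim \<nu> r \<le> ereal (r * q / (1 - q))"
proof -
  define a where "a = (1 - q) / (r * q)"
  have a: "a > 0" using assms by (simp add: a_def)
  obtain c where c: "c > 0"
    and ev: "\<forall>\<^sub>F n in sequentially. quant_error \<nu> n r \<le> c * real n powr (- a)"
    using quant_error_power_bound[OF assms] unfolding a_def by blast
  have "\<forall>\<^sub>F n in sequentially. 0 < a * ln (real n) - ln c" using a by real_asymp
  with ev have "\<forall>\<^sub>F n in sequentially.
      (if quant_error \<nu> n r = 0 then 0 else ln (real n) / (- ln (quant_error \<nu> n r)))
        \<le> ln (real n) / (a * ln (real n) - ln c)"
    using eventually_ge_at_top[of 1]
  proof eventually_elim
    case (elim n)
    show ?case
    proof (cases "quant_error \<nu> n r = 0")
      case True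
      then show ?thesis using elim by simp
    next
      case False
      then have pos: "quant_error \<nu> n r > 0" using quant_error_nonneg[of n r] elim by simp
      then have "ln (quant_error \<nu> n r) \<le> ln (c * real n powr (- a))"
        using elim by (intro ln_mono) auto
      also have "\<dots> = ln c - a * ln (real n)"
        using elim c by (simp add: ln_mult ln_powr)
      finally have "ln (real n) / (- ln (quant_error \<nu> n r)) \<le> ln (real n) / (a * ln (real n) - ln c)"
        using elim by (intro divide_left_mono mult_pos_pos) auto
      then show ?thesis using False by simp
    qed
  qed
  moreover have "(\<lambda>n. ln (real n) / (a * ln (real n) - ln c)) \<longlonglongrightarrow> inverse a"
    using a by real_asymp
  ultimately have "upper_quant_dim \<nu> r \<le> ereal (inverse a)"
    unfolding upper_quant_dim_def by (rule ereal_limsup_le_lim)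
  then show ?thesis by (simp add: a_def)
qed

section \<open>Vanishing of the errors and finiteness of the dimension\<close>

lemma exists_exponent_below_line:
  assumes "0 < r"
  obtains q where "0 < q" "q < 1" "Lq_spectrum \<nu> q < ereal (r * q)"
proof -
  have b: "\<beta> 0 \<ge> 0" using Lq_spectrum_nonneg[of 0] Lq_spectrum_real[of 0] by simp
  \<comment> \<open>The chord \<open>(1 - q) * \<beta> 0\<close> meets the line \<open>r * q\<close>
    at \<open>\<beta> 0 / (\<beta> 0 + r)\<close>; this is the midpoint between that and 1.\<close>
  define q where "q = (\<beta> 0 + r / 2) / (\<beta> 0 + r)"
  have q: "0 < q" "q < 1" using assms b by (auto simp: q_def field_simps)
  have "\<beta> q \<le> (1 - q) * \<beta> 0" using q by (intro \<beta>_le) auto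
  also have "\<dots> = r * (\<beta> 0 / 2) / (\<beta> 0 + r)"
    using assms b by (simp add: q_def field_simps)
  also have "\<dots> < r * (\<beta> 0 + r / 2) / (\<beta> 0 + r)"
    using assms b by (intro divide_strict_right_mono mult_strict_left_mono) auto
  finally have "\<beta> q < r * q" by (simp add: q_def)
  then show ?thesis using q by (intro that[of q]) (auto simp: Lq_spectrum_real)
qed

text \<open>Needed for the sign of \<open>- ln (quant_error \<nu> n r)\<close>, which must be
  positive before quotients are compared.\<close>

lemma quant_error_tendsto_0:
  assumes "0 < r"
  shows "(\<lambda>n. quant_error \<nu> n r) \<longlonglongrightarrow> 0"
proof -
  obtain q where q: "0 < q" "q < 1" "Lq_spectrum \<nu> q < ereal (r * q)"
    using exists_exponent_below_line[OF assms] .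
  define a where "a = (1 - q) / (r * q)"
  have a: "a > 0" using assms q by (simp add: a_def)
  obtain c where c: "c > 0"
    and ev: "\<forall>\<^sub>F n in sequentially. quant_error \<nu> n r \<le> c * real n powr (- a)"
    using quant_error_power_bound[OF assms q] unfolding a_def by blast
  have "(\<lambda>n. c * real n powr (- a)) \<longlonglongrightarrow> 0" using a by real_asymp
  moreover have "\<forall>\<^sub>F n in sequentially. 0 \<le> quant_error \<nu> n r"
    using quant_error_nonneg by (rule eventually_sequentiallyI[of 1])
  ultimately show ?thesis using ev by (intro tendsto_sandwich[OF _ ev tendsto_const])
qed

lemma upper_quant_dim_nonneg:
  assumes "0 < r"
  shows "0 \<le> upper_quant_dim \<nu> r"
proof -
  have "\<forall>\<^sub>F n in sequentially. quant_error \<nu> n r < 1"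
    using order_tendstoD(2)[OF quant_error_tendsto_0[OF assms]] by simp
  then have "\<forall>\<^sub>F n in sequentially.
      0 \<le> (if quant_error \<nu> n r = 0 then 0 else ln (real n) / (- ln (quant_error \<nu> n r)))"
    using eventually_ge_at_top[of 1]
  proof eventually_elim
    case (elim n)
    then have "0 \<le> - ln (quant_error \<nu> n r)" if "quant_error \<nu> n r \<noteq> 0"
      using that quant_error_nonneg[of n r] by simp
    then show ?case using elim by (simp add: divide_nonneg_nonneg del: minus_divide_right divide_minus_right)
  qed
  then show ?thesis
    unfolding upper_quant_dim_def zero_ereal_def by (rule ereal_limsup_ge)
qed

lemma upper_quant_dim_finite:
  assumes "0 < r"
  shows "upper_quant_dim \<nu> r = ereal (real_of_ereal (upper_quant_dim \<nu> r))"
proof -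
  obtain q where "0 < q" "q < 1" "Lq_spectrum \<nu> q < ereal (r * q)"
    using exists_exponent_below_line[OF assms] .
  from upper_quant_dim_le[OF assms this] upper_quant_dim_nonneg[OF assms]
  show ?thesis by (cases "upper_quant_dim \<nu> r") auto
qed

section \<open>Lower bound for the quantization dimension\<close>

text \<open>Each point of \<open>\<alpha>\<close> is within distance less than \<open>1 / 2 ^ m\<close> of at most
  \<open>card (cube_neighbours 0)\<close> cubes of level \<open>m\<close>, so at least half of the
  cubes in \<open>A\<close> stay away from \<open>\<alpha>\<close>.\<close>

lemma quantization_integral_ge:
  assumes "finite \<alpha>" "\<alpha> \<noteq> {}" "finite A" "0 < r" "0 \<le> t"
    and card: "2 * (card (cube_neighbours (\<lambda>_::'d. 0)) * card \<alpha>) \<le> card A"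
    and t: "\<And>k. k \<in> A \<Longrightarrow> t \<le> measure \<nu> (cube m k)"
  shows "real (card A) / 2 * (t * (1 / 2 ^ m) powr r) \<le> (\<integral>x. infdist x \<alpha> powr r \<partial>\<nu>)"
proof -
  define w :: real where "w = (1 / 2 ^ m) powr r"
  define N where "N = (\<Union>y\<in>\<alpha>. cube_neighbours (cube_index m y))"
  define B where "B = A - N"
  have finB: "finite B" using assms(3) by (simp add: B_def)
  have finN: "finite N" unfolding N_def using assms(1) finite_cube_neighbours by auto
  have "card N \<le> (\<Sum>y\<in>\<alpha>. card (cube_neighbours (cube_index m y)))"
    unfolding N_def using assms(1) by (rule card_UN_le)
  also have "\<dots> = card (cube_neighbours (\<lambda>_::'d. 0)) * card \<alpha>"
    by (subst card_cube_neighbours) simp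
  finally have "card A \<le> 2 * card B"
    using card diff_card_le_card_Diff[OF finN, of A] unfolding B_def by linarith
  then have "real (card A) / 2 \<le> real (card B)" by simp
  then have "real (card A) / 2 * (t * w) \<le> real (card B) * (t * w)"
    using assms(5) by (intro mult_right_mono) (auto simp: w_def)
  also have "\<dots> = (\<Sum>k\<in>B. t * w)" by simp
  also have "\<dots> \<le> (\<Sum>k\<in>B. measure \<nu> (cube m k) * w)"
    using t by (intro sum_mono mult_right_mono) (auto simp: B_def w_def)
  also have "\<dots> = (\<integral>x. (\<Sum>k\<in>B. indicator (cube m k) x * w) \<partial>\<nu>)"
    by (subst Bochner_Integration.integral_sum) (auto simp: emeasure_eq_measure)
  also have "\<dots> \<le> (\<integral>x. infdist x \<alpha> powr r \<partial>\<nu>)"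
  proof (intro integral_mono integrable_infdist_powr assms Bochner_Integration.integrable_sum
      integrable_mult_left integrable_real_indicator)
    fix x
    \<comment> \<open>The cubes of one level are disjoint, so at most one term survives.\<close>
    have "(\<Sum>k\<in>B. indicator (cube m k) x * w) = (\<Sum>k\<in>B. if k = cube_index m x then w else 0)"
      by (intro sum.cong) (auto simp: indicator_def mem_cube_iff)
    also have "\<dots> = (if cube_index m x \<in> B then w else 0)"
      using finB by simp
    also have "\<dots> \<le> infdist x \<alpha> powr r"
    proof (cases "cube_index m x \<in> B")
      case True
      have "1 / 2 ^ m \<le> infdist x \<alpha>"
        unfolding infdist_notempty[OF assms(2)]
        using True assms(2) by (intro cINF_greatest dist_non_neighbours_ge) (auto simp: B_def N_def)
      then show ?thesis using True assms(4) by (auto simp: w_def intro!: powr_mono2)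
    qed simp
    finally show "(\<Sum>k\<in>B. indicator (cube m k) x * w) \<le> infdist x \<alpha> powr r" .
  qed (auto simp: emeasure_eq_measure)
  finally show ?thesis by (simp add: w_def)
qed

text \<open>Eventually the error lies below \<open>n powr (- (1 / s))\<close>. A strict bound on an
  infimum yields an actual point set, and the power \<open>r\<close> gives the integral.\<close>

lemma eventually_good_quantizer:
  assumes "0 < r" "0 < s" "upper_quant_dim \<nu> r < ereal s"
  shows "\<forall>\<^sub>F n in sequentially. \<exists>\<alpha>. finite \<alpha> \<and> \<alpha> \<noteq> {} \<and> card \<alpha> \<le> n \<and>
           (\<integral>x. infdist x \<alpha> powr r \<partial>\<nu>) \<le> 2 powr r * real n powr (- (r / s))"
proof -
  have "\<forall>\<^sub>F n in sequentially. quant_error \<nu> n r < 1"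
    using order_tendstoD(2)[OF quant_error_tendsto_0[OF assms(1)]] by simp
  moreover have "\<forall>\<^sub>F n in sequentially.
      (if quant_error \<nu> n r = 0 then 0 else ln (real n) / (- ln (quant_error \<nu> n r))) < s"
    using assms(3) unfolding upper_quant_dim_def by (rule ereal_limsup_lessD)
  ultimately show ?thesis using eventually_ge_at_top[of 1]
  proof eventually_elim
    case (elim n)
    have "quant_error \<nu> n r < 2 * real n powr (- (1 / s))"
    proof (cases "quant_error \<nu> n r = 0")
      case True
      then show ?thesis using elim by simp
    next
      case False
      then have e: "0 < quant_error \<nu> n r" using quant_error_nonneg[of n r] elim by simp
      have pos: "0 < - ln (quant_error \<nu> n r)" using elim e by simp
      have "ln (real n) / (- ln (quant_error \<nu> n r)) < s" using elim False by simp
      then have "ln (real n) < s * (- ln (quant_error \<nu> n r))"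
        using pos by (simp only: pos_divide_less_eq)
      then have "ln (quant_error \<nu> n r) < - (1 / s) * ln (real n)"
        using assms(2) by (simp add: field_simps)
      also have "\<dots> = ln (real n powr (- (1 / s)))" using elim by (simp add: ln_powr)
      finally have "quant_error \<nu> n r < real n powr (- (1 / s))"
        using e elim by (subst (asm) ln_less_cancel_iff) auto
      then show ?thesis using powr_ge_zero[of "real n" "- (1 / s)"] by linarith
    qed
    then obtain \<alpha> where \<alpha>: "finite \<alpha>" "\<alpha> \<noteq> {}" "card \<alpha> \<le> n"
      "(\<integral>x. infdist x \<alpha> powr r \<partial>\<nu>) powr (1 / r) < 2 * real n powr (- (1 / s))"
      using elim by (elim quant_error_lessD) auto
    have "(\<integral>x. infdist x \<alpha> powr r \<partial>\<nu>) = ((\<integral>x. infdist x \<alpha> powr r \<partial>\<nu>) powr (1 / r)) powr r"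
      using assms(1) by (simp add: powr_powr)
    also have "\<dots> \<le> (2 * real n powr (- (1 / s))) powr r"
      using \<alpha>(4) assms(1) by (intro powr_mono2) auto
    also have "\<dots> = 2 powr r * real n powr (- (r / s))"
      by (simp add: powr_mult powr_powr)
    finally show ?case using \<alpha> by blast
  qed
qed

text \<open>For \<open>N\<close> heavy cubes and a quantizer of size comparable to \<open>N\<close>,
  the two bounds on the integral give \<open>N powr (1 + r / s) \<le> K1 / (t * w)\<close>, and
  \<open>s / (r + s)\<close> is the reciprocal of that exponent.\<close>

lemma heavy_cubes_bound:
  assumes "0 < r" "0 < s" "upper_quant_dim \<nu> r < ereal s"
  obtains K :: real where "K > 0" and
    "\<And>m t. 0 < t \<Longrightarrow> t \<le> 1 \<Longrightarrow> real (card {k \<in> pos_cubes m. t \<le> measure \<nu> (cube m k)})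
        \<le> K * (1 / (t * (1 / 2 ^ m) powr r)) powr (s / (r + s))"
proof -
  define T where "T = card (cube_neighbours (\<lambda>_::'d. 0))"
  have T: "T \<ge> 1" using card_cube_neighbours_pos[of "\<lambda>_::'d. 0"] by (simp add: T_def Suc_le_eq)
  obtain n0 where n0: "\<And>n. n \<ge> n0 \<Longrightarrow> \<exists>\<alpha>. finite \<alpha> \<and> \<alpha> \<noteq> {} \<and> card \<alpha> \<le> n \<and>
           (\<integral>x. infdist x \<alpha> powr r \<partial>\<nu>) \<le> 2 powr r * real n powr (- (r / s))"
    using eventually_good_quantizer[OF assms] by (auto simp: eventually_sequentially)
  define n1 where "n1 = max n0 1"
  define q where "q = s / (r + s)"
  have q: "q > 0" using assms by (simp add: q_def)
  have "1 + r / s = (r + s) / s" using assms(2) by (simp add: add_divide_distrib)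
  then have q_inv: "(1 + r / s) * q = 1" using assms by (simp add: q_def)
  \<comment> \<open>The factors come from keeping half the cubes, from the quantizer bound, and from
    \<open>N < 4 * T * n\<close>. The second summand of \<open>K\<close> covers the small
    \<open>N\<close>, for which \<open>n < n1\<close>.\<close>
  define K1 where "K1 = 2 * 2 powr r * (4 * real T) powr (r / s)"
  define K where "K = K1 powr q + real (2 * T * n1)"
  have "K1 > 0" using T by (simp add: K1_def)
  show ?thesis
  proof (rule that[of K])
    show "K > 0" using \<open>K1 > 0\<close> by (simp add: K_def add_pos_nonneg)
    fix m :: nat and t :: real assume t: "0 < t" "t \<le> 1"
    define w :: real where "w = (1 / 2 ^ m) powr r"
    have w: "0 < w" "w \<le> 1" using assms(1) by (auto simp: w_def intro!: powr_le1)
    define A where "A = {k \<in> pos_cubes m. t \<le> measure \<nu> (cube m k)}"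
    define N where "N = card A"
    \<comment> \<open>The largest number of points whose neighbourhoods are sure to miss half of the
      \<open>N\<close> cubes.\<close>
    define n where "n = N div (2 * T)"
    have finA: "finite A" using finite_pos_cubes by (simp add: A_def)
    have tw: "0 < t * w" "t * w \<le> 1" using t w by (auto intro: mult_le_one)
    have "real N \<le> K * (1 / (t * w)) powr q"
    proof (cases "n \<ge> n1")
      case True
      then have n: "n \<ge> n0" "n \<ge> 1" by (auto simp: n1_def)
      obtain \<alpha> where \<alpha>: "finite \<alpha>" "\<alpha> \<noteq> {}" "card \<alpha> \<le> n"
        "(\<integral>x. infdist x \<alpha> powr r \<partial>\<nu>) \<le> 2 powr r * real n powr (- (r / s))"
        using n0[OF n(1)] by blast
      have "2 * (T * n) \<le> N" unfolding n_def by (metis mult.assoc times_div_less_eq_dividend)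
      moreover have "2 * (T * card \<alpha>) \<le> 2 * (T * n)" using \<alpha>(3) by simp
      ultimately have cardA: "2 * (T * card \<alpha>) \<le> card A" unfolding N_def by linarith
      have "N < 2 * T * (n + 1)"
        unfolding n_def using T dividend_less_times_div[of "2 * T" N] by (simp add: algebra_simps)
      also have "\<dots> \<le> 4 * T * n" using n T by simp
      finally have "real N < real (4 * T * n)" by (simp only: of_nat_less_iff)
      then have N_less: "real N / (4 * real T) < real n"
        using T by (simp add: divide_less_eq mult_ac)
      have Npos: "N > 0" using n(2) unfolding n_def by (cases "N = 0") auto
      have "real N / 2 * (t * w) \<le> (\<integral>x. infdist x \<alpha> powr r \<partial>\<nu>)"
        unfolding N_def w_def using \<alpha> finA assms(1) t cardA
        by (intro quantization_integral_ge) (auto simp: T_def A_def)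
      also have "\<dots> \<le> 2 powr r * real n powr (- (r / s))" by fact
      also have "\<dots> \<le> 2 powr r * (real N / (4 * real T)) powr (- (r / s))"
        using N_less Npos T assms by (intro mult_left_mono powr_mono2') auto
      also have "\<dots> = K1 / 2 * real N powr (- (r / s))"
        using Npos T by (simp add: K1_def powr_divide powr_minus_divide)
      finally have "real N * real N powr (r / s) \<le> K1 * (1 / (t * w))"
        using Npos tw by (simp add: powr_minus_divide field_simps)
      then have "real N powr (1 + r / s) \<le> K1 * (1 / (t * w))"
        using Npos by (simp add: powr_add)
      then have "(real N powr (1 + r / s)) powr q \<le> (K1 * (1 / (t * w))) powr q"
        using q by (intro powr_mono2) auto
      then have "real N \<le> K1 powr q * (1 / (t * w)) powr q"
        unfolding powr_powr q_inv using Npos \<open>K1 > 0\<close> tw by (simp flip: powr_mult)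
      also have "\<dots> \<le> K * (1 / (t * w)) powr q"
        by (intro mult_right_mono) (auto simp: K_def)
      finally show ?thesis .
    next
      case False
      have "N < 2 * T * (n + 1)"
        unfolding n_def using T dividend_less_times_div[of "2 * T" N] by (simp add: algebra_simps)
      also have "\<dots> \<le> 2 * T * n1" using False by (intro mult_left_mono) auto
      finally have "real N \<le> real (2 * T * n1)" by linarith
      also have "\<dots> \<le> K" by (simp add: K_def)
      also have "K * 1 \<le> K * (1 / (t * w)) powr q"
        using tw q \<open>K > 0\<close> by (intro mult_left_mono ge_one_powr_ge_zero) auto
      finally show ?thesis by simp
    qed
    then show "real (card {k \<in> pos_cubes m. t \<le> measure \<nu> (cube m k)})
        \<le> K * (1 / (t * (1 / 2 ^ m) powr r)) powr (s / (r + s))"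
      by (simp only: N_def A_def w_def q_def)
  qed
qed

text \<open>With the measure of each cube as threshold, the heavy-cube count is the weak bound to be
  summed. The harmonic factor is at most linear in \<open>m\<close>, so its logarithm vanishes after
  division by \<open>m\<close>.\<close>

lemma Lq_spectrum_le:
  assumes "0 < r" "0 < s" "upper_quant_dim \<nu> r < ereal s"
  shows "Lq_spectrum \<nu> (s / (r + s)) \<le> ereal (r * (s / (r + s)))"
proof -
  define q where "q = s / (r + s)"
  have q: "q > 0" using assms by (simp add: q_def)
  obtain K where K: "K > 0" and heavy:
    "\<And>m t. 0 < t \<Longrightarrow> t \<le> 1 \<Longrightarrow> real (card {k \<in> pos_cubes m. t \<le> measure \<nu> (cube m k)})
        \<le> K * (1 / (t * (1 / 2 ^ m) powr r)) powr q"
    unfolding q_def using heavy_cubes_bound[OF assms] by blast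
  obtain M where M: "M \<ge> 1" "\<And>n. real (card (pos_cubes n)) \<le> M * (2 ^ CARD('d)) ^ n"
    using pos_cubes_bound by metis
  define D where "D = real CARD('d) * ln 2"
  have D: "D > 0" by (simp add: D_def)
  define L where "L = 1 + ln M"
  have L: "L > 0" using M(1) by (simp add: L_def add_pos_nonneg)
  have "ln (partition_sum m q) / ln (2 ^ m)
      \<le> (ln K + real m * (r * q * ln 2) + ln (L + real m * D)) / (real m * ln 2)" for m
  proof -
    \<comment> \<open>This is 2 to the power \<open>m * r * q\<close>, the source of the limit
      \<open>r * q\<close>.\<close>
    define W where "W = (1 / (1 / 2 ^ m) powr r) powr q"
    have W: "W > 0" by (simp add: W_def)
    have "ln W = real m * (r * q * ln 2)"
      by (simp add: W_def ln_powr ln_div ln_realpow)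
    have cm: "card (pos_cubes m) \<ge> 1"
      using pos_cubes_nonempty finite_pos_cubes by (simp add: Suc_le_eq card_gt_0_iff)
    have "ln (real (card (pos_cubes m))) \<le> ln (M * (2 ^ CARD('d)) ^ m)"
      using M(2)[of m] cm by simp
    also have "\<dots> = ln M + real m * D"
      using M(1) by (simp add: ln_mult ln_realpow D_def)
    finally have harm: "harm (card (pos_cubes m)) \<le> L + real m * D"
      using harm_le_1_plus_ln[OF cm] by (simp add: L_def)
    have "partition_sum m q \<le> K * W * harm (card (pos_cubes m))"
      unfolding partition_sum_def
    proof (rule sum_le_harm_if_weak_bound)
      fix a assume a: "a \<in> pos_cubes m"
      then have pos: "0 < measure \<nu> (cube m a)" by (rule measure_cube_pos)
      have "{b \<in> pos_cubes m. measure \<nu> (cube m a) powr q \<le> measure \<nu> (cube m b) powr q}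
          = {b \<in> pos_cubes m. measure \<nu> (cube m a) \<le> measure \<nu> (cube m b)}"
        using q by (metis (no_types, lifting) less_imp_le measure_nonneg not_le powr_less_mono2 powr_mono2)
      then have "real (card {b \<in> pos_cubes m. measure \<nu> (cube m a) powr q \<le> measure \<nu> (cube m b) powr q})
          \<le> K * (1 / (measure \<nu> (cube m a) * (1 / 2 ^ m) powr r)) powr q"
        using heavy[OF pos] by simp
      also have "\<dots> = K * W / measure \<nu> (cube m a) powr q"
        unfolding W_def using pos by (simp add: powr_divide powr_mult)
      finally show "real (card {b \<in> pos_cubes m. measure \<nu> (cube m a) powr q \<le> measure \<nu> (cube m b) powr q})
          * measure \<nu> (cube m a) powr q \<le> K * W"
        using pos by (simp add: pos_le_divide_eq)
    qed (auto simp: finite_pos_cubes)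
    also have "\<dots> \<le> K * W * (L + real m * D)"
      using harm K W by (intro mult_left_mono) auto
    finally have "ln (partition_sum m q) \<le> ln (K * W * (L + real m * D))"
      using partition_sum_pos by (intro ln_mono)
    also have "\<dots> = ln K + real m * (r * q * ln 2) + ln (L + real m * D)"
      using K W L D \<open>ln W = _\<close> by (simp add: ln_mult add_pos_nonneg[THEN less_imp_neq, symmetric])
    finally show ?thesis by (simp add: ln_realpow divide_right_mono)
  qed
  moreover have "(\<lambda>m. (ln K + real m * (r * q * ln 2) + ln (L + real m * D)) / (real m * ln 2))
      \<longlonglongrightarrow> r * q"
    using D L by real_asymp
  ultimately show ?thesis
    unfolding Lq_spectrum_eq q_def[symmetric] by (intro ereal_limsup_le_lim) auto
qed

section \<open>The critical exponent\<close>

definition \<delta> :: "real \<Rightarrow> real" where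
  "\<delta> r = real_of_ereal (upper_quant_dim \<nu> r)"

lemma upper_quant_dim_eq: "0 < r \<Longrightarrow> upper_quant_dim \<nu> r = ereal (\<delta> r)"
  unfolding \<delta>_def by (rule upper_quant_dim_finite)

lemma \<delta>_nonneg: "0 < r \<Longrightarrow> 0 \<le> \<delta> r"
  using upper_quant_dim_nonneg[of r] by (simp add: upper_quant_dim_eq)

text \<open>The bound from \<open>Lq_spectrum_le\<close> is not strict. Applied at some
  \<open>p\<close> strictly between the critical value and \<open>q\<close>, it becomes strict
  because \<open>r * p < r * q\<close>.\<close>

lemma Lq_spectrum_above_crit:
  assumes r: "0 < r" and q: "\<delta> r / (r + \<delta> r) < q"
  shows "Lq_spectrum \<nu> q < ereal (r * q)"
proof -
  have \<delta>: "0 \<le> \<delta> r" using r by (rule \<delta>_nonneg)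
  have "0 \<le> \<delta> r / (r + \<delta> r)" using r \<delta> by simp
  with q have q0: "0 < q" by linarith
  show ?thesis
  proof (cases "q < 1")
    case False
    then have "Lq_spectrum \<nu> q \<le> 0" using Lq_spectrum_antimono[of 1 q] by (simp add: Lq_spectrum_1)
    also have "\<dots> < ereal (r * q)" using r q0 by simp
    finally show ?thesis .
  next
    case True
    obtain p where p: "\<delta> r / (r + \<delta> r) < p" "p < q" using q dense by blast
    have p01: "0 < p" "p < 1" using p True \<open>0 \<le> \<delta> r / (r + \<delta> r)\<close> by linarith+
    \<comment> \<open>Solves \<open>s / (r + s) = p\<close>.\<close>
    define s where "s = r * p / (1 - p)"
    have "\<delta> r < s" using p(1) p01 r \<delta> by (simp add: s_def field_simps)
    moreover have "s / (r + s) = p" using p01 r by (simp add: s_def field_simps)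
    ultimately have "Lq_spectrum \<nu> p \<le> ereal (r * p)"
      using Lq_spectrum_le[of r s] r \<delta> by (simp add: upper_quant_dim_eq)
    with Lq_spectrum_antimono[of p q] p(2) have "Lq_spectrum \<nu> q \<le> ereal (r * p)"
      by (auto intro: order_trans)
    also have "\<dots> < ereal (r * q)" using p(2) r by simp
    finally show ?thesis .
  qed
qed

text \<open>The contrapositive of \<open>upper_quant_dim_le\<close>.\<close>

lemma Lq_spectrum_below_crit:
  assumes r: "0 < r" and "0 < q" "q < \<delta> r / (r + \<delta> r)"
  shows "ereal (r * q) \<le> Lq_spectrum \<nu> q"
proof (rule ccontr)
  assume "\<not> ?thesis"
  moreover have "\<delta> r / (r + \<delta> r) \<le> 1" using r \<delta>_nonneg[OF r] by simp
  then have q1: "q < 1" using assms(3) by linarith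
  ultimately have "\<delta> r \<le> r * q / (1 - q)"
    using upper_quant_dim_le[of r q] assms by (simp add: upper_quant_dim_eq)
  with assms \<delta>_nonneg[OF r] q1 show False by (simp add: field_simps)
qed

lemma crit_exponent_eq:
  assumes r: "0 < r"
  shows "crit_exponent \<nu> r = \<delta> r / (r + \<delta> r)"
proof -
  define S where "S = {q. q > 0 \<and> Lq_spectrum \<nu> q < ereal (r * q)}"
  have d: "0 \<le> \<delta> r / (r + \<delta> r)" using r \<delta>_nonneg[OF r] by simp
  have above: "q \<in> S" if "\<delta> r / (r + \<delta> r) < q" for q
    using that d Lq_spectrum_above_crit[OF r that] by (auto simp: S_def)
  have below: "\<delta> r / (r + \<delta> r) \<le> q" if "q \<in> S" for q
    using that Lq_spectrum_below_crit[OF r, of q] by (force simp: S_def not_le[symmetric])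
  have "Inf S = \<delta> r / (r + \<delta> r)"
  proof (rule antisym)
    show "Inf S \<le> \<delta> r / (r + \<delta> r)"
    proof (rule dense_ge)
      fix q assume "\<delta> r / (r + \<delta> r) < q"
      then show "Inf S \<le> q"
        using below by (intro cInf_lower above bdd_belowI) auto
    qed
    have "S \<noteq> {}" using above[of "\<delta> r / (r + \<delta> r) + 1"] by auto
    then show "\<delta> r / (r + \<delta> r) \<le> Inf S" using below by (rule cInf_greatest)
  qed
  then show ?thesis by (simp add: crit_exponent_def S_def)
qed

text \<open>Positivity of \<open>\<delta> r\<close> puts the critical value inside
  \<open>(0, 1)\<close>, where convexity makes \<open>\<beta>\<close> continuous. One-sided limits
  of \<open>\<beta> q - r * q\<close> then give both inequalities.\<close>

lemma \<beta>_at_crit: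
  assumes r: "0 < r" and pos: "0 < \<delta> r"
  shows "\<beta> (\<delta> r / (r + \<delta> r)) = r * (\<delta> r / (r + \<delta> r))"
proof -
  define p where "p = \<delta> r / (r + \<delta> r)"
  have p: "0 < p" "p < 1" using r pos by (auto simp: p_def field_simps)
  have "isCont \<beta> p"
    using continuous_on_\<beta> p by (simp add: continuous_on_eq_continuous_at)
  then have cont: "isCont (\<lambda>q. \<beta> q - r * q) p" by (intro continuous_intros)
  have "\<beta> p - r * p \<le> 0"
  proof (rule tendsto_upperbound)
    show "((\<lambda>q. \<beta> q - r * q) \<longlongrightarrow> \<beta> p - r * p) (at_right p)"
      using cont by (simp add: isCont_def filterlim_at_split)
    show "\<forall>\<^sub>F q in at_right p. \<beta> q - r * q \<le> 0"
      unfolding eventually_at_right[OF p(2)]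
    proof (intro exI[of _ 1] conjI allI impI p)
      fix q assume "p < q" "q < 1"
      then show "\<beta> q - r * q \<le> 0"
        using Lq_spectrum_above_crit[OF r, of q] Lq_spectrum_real[of q] p by (simp add: p_def)
    qed
  qed simp
  moreover have "0 \<le> \<beta> p - r * p"
  proof (rule tendsto_lowerbound)
    show "((\<lambda>q. \<beta> q - r * q) \<longlongrightarrow> \<beta> p - r * p) (at_left p)"
      using cont by (simp add: isCont_def filterlim_at_split)
    show "\<forall>\<^sub>F q in at_left p. 0 \<le> \<beta> q - r * q"
      unfolding eventually_at_left[OF p(1)]
    proof (intro exI[of _ 0] conjI allI impI p)
      fix q assume "0 < q" "q < p"
      then show "0 \<le> \<beta> q - r * q"
        using Lq_spectrum_below_crit[OF r, of q] Lq_spectrum_real[of q] p by (simp add: p_def)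
    qed
  qed simp
  ultimately show ?thesis by (simp add: p_def)
qed

text \<open>For \<open>r = \<beta> q / q\<close> the line of slope \<open>r\<close> meets
  \<open>\<beta>\<close> at \<open>q\<close>. The line increases strictly while the spectrum does
  not increase, so \<open>q\<close> is the critical value; solving
  \<open>q = \<delta> r / (r + \<delta> r)\<close> finishes.\<close>

lemma \<delta>_at_\<beta>_slope:
  assumes q: "0 < q" "q < 1" and pos: "0 < \<beta> q"
  shows "\<delta> (\<beta> q / q) = \<beta> q / (1 - q)"
proof -
  define r where "r = \<beta> q / q"
  have r: "0 < r" "r * q = \<beta> q" using q pos by (auto simp: r_def)
  define p where "p = \<delta> r / (r + \<delta> r)"
  have p: "0 \<le> p" "p \<le> 1" using r(1) \<delta>_nonneg[OF r(1)] by (auto simp: p_def)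
  have "p = q"
  proof (rule antisym; rule ccontr)
    assume "\<not> p \<le> q"
    then obtain q' where q': "q < q'" "q' < p" using dense[of q p] by (auto simp: not_le)
    have "r * q < r * q'" using q' r(1) by simp
    also have "ereal (r * q') \<le> Lq_spectrum \<nu> q'"
      using q q' r(1) by (intro Lq_spectrum_below_crit) (auto simp: p_def)
    also have "\<dots> \<le> Lq_spectrum \<nu> q" using q' by (intro Lq_spectrum_antimono) simp
    also have "\<dots> = ereal (r * q)" using q r(2) by (simp add: Lq_spectrum_real)
    finally show False by simp
  next
    assume "\<not> q \<le> p"
    then have "Lq_spectrum \<nu> q < ereal (r * q)"
      using r(1) by (intro Lq_spectrum_above_crit) (auto simp: p_def)
    then show False using q r(2) by (simp add: Lq_spectrum_real)
  qed
  then show ?thesis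
    using r q \<delta>_nonneg[OF r(1)] unfolding p_def r_def[symmetric] by (simp add: field_simps)
qed

end

theorem mainTheorem2:
  fixes \<nu> :: "(real ^ 'd) measure"
  assumes "prob_space \<nu>"
    and "sets \<nu> = sets borel"
    and "compact (msupport \<nu>)"
  shows "(\<forall>r::real. r > 0 \<longrightarrow>
            ereal (crit_exponent \<nu> r) = upper_quant_dim \<nu> r / (ereal r + upper_quant_dim \<nu> r)) \<and>
         (\<forall>r::real. r > 0 \<and> upper_quant_dim \<nu> r > 0 \<longrightarrow>
            Lq_spectrum \<nu> (real_of_ereal (upper_quant_dim \<nu> r / (upper_quant_dim \<nu> r + ereal r)))
              = ereal r * upper_quant_dim \<nu> r / (upper_quant_dim \<nu> r + ereal r)) \<and>
         (let q0 = (SUP r\<in>{0::real<..}. upper_quant_dim \<nu> r / (ereal r + upper_quant_dim \<nu> r)) in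
            (\<forall>q::real. q0 < ereal q \<and> q \<le> 1 \<longrightarrow> Lq_spectrum \<nu> q = 0) \<and>
            (\<forall>q::real. 0 < q \<and> ereal q < q0 \<longrightarrow>
               Lq_spectrum \<nu> q > 0 \<and>
               upper_quant_dim \<nu> (real_of_ereal (Lq_spectrum \<nu> q) / q)
                 = Lq_spectrum \<nu> q / ereal (1 - q)))"
proof -
  interpret compact_prob \<nu>
    using assms by (simp add: compact_prob_def compact_prob_axioms_def)
  define p where "p r = \<delta> r / (r + \<delta> r)" for r
  define q0 where "q0 = (SUP r\<in>{0::real<..}. upper_quant_dim \<nu> r / (ereal r + upper_quant_dim \<nu> r))"
  have ratio: "upper_quant_dim \<nu> r / (ereal r + upper_quant_dim \<nu> r) = ereal (p r)" if "0 < r" for r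
    using that \<delta>_nonneg[OF that] by (simp add: upper_quant_dim_eq p_def)
  have p: "0 \<le> p r" "p r \<le> 1" if "0 < r" for r
    using that \<delta>_nonneg[OF that] by (auto simp: p_def)
  have q0: "q0 = (SUP r\<in>{0::real<..}. ereal (p r))"
    unfolding q0_def by (intro SUP_cong) (auto simp: ratio)
  have "Lq_spectrum \<nu> (real_of_ereal (upper_quant_dim \<nu> r / (upper_quant_dim \<nu> r + ereal r)))
              = ereal r * upper_quant_dim \<nu> r / (upper_quant_dim \<nu> r + ereal r)"
    if r: "r > 0" "upper_quant_dim \<nu> r > 0" for r
  proof -
    have \<delta>: "0 < \<delta> r" using r by (simp add: upper_quant_dim_eq)
    have "Lq_spectrum \<nu> (p r) = ereal (r * p r)"
      using \<beta>_at_crit[OF r(1) \<delta>] p[OF r(1)] by (simp add: Lq_spectrum_real p_def)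
    then show ?thesis
      using r \<delta> by (simp add: upper_quant_dim_eq p_def add.commute)
  qed
  moreover have "Lq_spectrum \<nu> q = 0" if q: "q0 < ereal q" "q \<le> 1" for q
  proof -
    have pq: "p r < q" if "0 < r" for r
    proof -
      have "ereal (p r) \<le> q0" unfolding q0 using that by (intro SUP_upper) simp
      then have "ereal (p r) < ereal q" using q(1) by (rule le_less_trans)
      then show ?thesis by simp
    qed
    have qpos: "0 < q" using pq[of 1] p[of 1] by simp
    have "Lq_spectrum \<nu> q \<le> 0 + ereal e" if "0 < e" for e
    proof -
      \<comment> \<open>Since \<open>q\<close> exceeds the critical value of every order, the order
        \<open>e / q\<close> may be chosen, whose line has height \<open>e\<close> at
        \<open>q\<close>.\<close>
      have "Lq_spectrum \<nu> q < ereal (e / q * q)"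
        using that qpos pq[of "e / q"] by (intro Lq_spectrum_above_crit) (auto simp: p_def)
      then show ?thesis using qpos by simp
    qed
    then have "Lq_spectrum \<nu> q \<le> 0" by (rule ereal_le_epsilon2)
    then show ?thesis using Lq_spectrum_nonneg[OF q(2)] by (rule antisym)
  qed
  moreover have "Lq_spectrum \<nu> q > 0 \<and>
      upper_quant_dim \<nu> (real_of_ereal (Lq_spectrum \<nu> q) / q) = Lq_spectrum \<nu> q / ereal (1 - q)"
    if q: "0 < q" "ereal q < q0" for q
  proof -
    \<comment> \<open>Being below the supremum, \<open>q\<close> is below the critical value of some
      order \<open>r\<close>, whence the spectrum is at least \<open>r * q > 0\<close>.\<close>
    obtain r where r: "0 < r" "q < p r"
      using q(2) unfolding q0 less_SUP_iff by auto
    have q1: "q < 1" using r p[of r] by simp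
    have "0 < r * q" using r q by simp
    also have "ereal (r * q) \<le> Lq_spectrum \<nu> q"
      using r q by (intro Lq_spectrum_below_crit) (auto simp: p_def)
    finally have pos: "0 < \<beta> q" using q q1 by (simp add: Lq_spectrum_real)
    have "upper_quant_dim \<nu> (\<beta> q / q) = ereal (\<beta> q / (1 - q))"
      using pos q q1 by (simp add: upper_quant_dim_eq \<delta>_at_\<beta>_slope)
    then show ?thesis using pos q q1 by (simp add: Lq_spectrum_real)
  qed
  ultimately show ?thesis
    unfolding Let_def q0_def[symmetric] using ratio crit_exponent_eq by (simp add: p_def)
qed

end
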